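(* Let $(\mathcal X^n)_{n\ge 1}$ be a large market as described in the context, with numéraire portfolios $V^n\in\mathcal X^n_1$. The following conditions are equivalent: (a) SAA (there exists a strong asymptotic arbitrage on $(\mathcal X^n)$); (b) $\liminf_{n\to\infty}\mathsf E_{\mathsf P^n} (V^n_T)^{-\alpha}=0$ for some $\alpha\in (0,1)$; (c) there exists a sequence $Y^n\in\mathcal X^n_1$ such that $\liminf_{n\to\infty}\mathsf E_{\mathsf P^n} (Y^n_T)^{-\alpha}=0$ for some $\alpha\in (0,1)$.
   Context: Setting. For each $n\ge1$, $(\Omega^n,\mathcal F^n_T,\mathsf P^n)$ is a probability space with a filtration $\mathbb F^n=(\mathcal F^n_t)_{t\in\mathbb T^n}$, where $\mathbb T^n$ is an interval $[0,T(n)]$ or a set of integers $\{0,\dots,T(n)\}$; the $\sigma$-algebra $\mathcal F^n_0$ is trivial up to $\mathsf P^n$-null sets. A subscript $T$ on an object of the $n$-th market means $T(n)$ (so $\mathcal F^n_T=\mathcal F^n_{T(n)}$, $X^n_T=X^n_{T(n)}$). $\mathcal X^n$ is a family of non-negative $\mathbb F^n$-adapted processes such that: (i) $1\in\mathcal X^n$, and $X\in\mathcal X^n$, $\lambda>0$ imply $\lambda X\in\mathcal X^n$; (ii) there is a strictly positive process (numéraire portfolio) $V^n\in\mathcal X^n_1=\{X^n\in\mathcal X^n: X^n_0=1\}$ such that $X^n/V^n$ is a $\mathsf P^n$-supermartingale for all $X^n\in\mathcal X^n$. The large market is the sequence $(\mathcal X^n)_{n\ge1}$. SAA (strong asymptotic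 arbitrage): there is a sequence $X^n\in\mathcal X^n$ with $X^n_0\to0$ and $\limsup_{n\to\infty}\mathsf P^n(X^n_T\ge1)=1$. Convention: $0^{-\alpha}=+\infty$ for $\alpha\in(0,1)$; expectations of non-negative variables take values in $[0,+\infty]$. *)

theory Defs
  imports "HOL-Probability.Probability"
begin

text \<open>
  Times are real numbers, so a process is a function of type \<open>real \<Rightarrow> 'a \<Rightarrow> real\<close> and a filtration a
  function of type \<open>real \<Rightarrow> 'a measure\<close> of which only the \<open>\<sigma>\<close>-algebras are used. Their values at
  times outside the time set \<open>I\<close> are irrelevant.
\<close>

definition time_set :: "real set \<Rightarrow> real \<Rightarrow> bool" where
  "time_set I T \<longleftrightarrow> 0 \<le> T \<and> (I = {0..T} \<or> (\<exists>N::nat. T = real N \<and> I = real ` {0..N}))"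

definition adapted :: "real set \<Rightarrow> (real \<Rightarrow> 'a measure) \<Rightarrow> (real \<Rightarrow> 'a \<Rightarrow> real) \<Rightarrow> bool" where
  "adapted I F X \<longleftrightarrow> (\<forall>t\<in>I. X t \<in> borel_measurable (F t))"

definition supermartingale ::
  "'a measure \<Rightarrow> real set \<Rightarrow> (real \<Rightarrow> 'a measure) \<Rightarrow> (real \<Rightarrow> 'a \<Rightarrow> real) \<Rightarrow> bool" where
  "supermartingale M I F X \<longleftrightarrow>
     adapted I F X \<and> (\<forall>t\<in>I. integrable M (X t)) \<and>
     (\<forall>s\<in>I. \<forall>t\<in>I. s \<le> t \<longrightarrow> (AE \<omega> in M. real_cond_exp M (F s) (X t) \<omega> \<le> X s \<omega>))"

text \<open>
  The initial \<open>\<sigma>\<close>-algebra is trivial only up to null sets, so the initial value of an adapted process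
  is a number only almost surely.
\<close>

definition starts_at :: "'a measure \<Rightarrow> (real \<Rightarrow> 'a \<Rightarrow> real) \<Rightarrow> real \<Rightarrow> bool" where
  "starts_at M X x \<longleftrightarrow> (AE \<omega> in M. X 0 \<omega> = x)"

definition unit_processes ::
  "'a measure \<Rightarrow> (real \<Rightarrow> 'a \<Rightarrow> real) set \<Rightarrow> (real \<Rightarrow> 'a \<Rightarrow> real) set" where
  "unit_processes M \<X> = {X \<in> \<X>. starts_at M X 1}"

definition numeraire_portfolio ::
  "'a measure \<Rightarrow> real set \<Rightarrow> (real \<Rightarrow> 'a measure) \<Rightarrow> (real \<Rightarrow> 'a \<Rightarrow> real) set
     \<Rightarrow> (real \<Rightarrow> 'a \<Rightarrow> real) \<Rightarrow> bool" where
  "numeraire_portfolio M I F \<X> V \<longleftrightarrow>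
     V \<in> unit_processes M \<X> \<and>
     (\<forall>t\<in>I. \<forall>\<omega>\<in>space M. V t \<omega> > 0) \<and>
     (\<forall>X\<in>\<X>. supermartingale M I F (\<lambda>t \<omega>. X t \<omega> / V t \<omega>))"

locale market = prob_space M
  for M :: "'a measure" +
  fixes I :: "real set" and T :: real
    and F :: "real \<Rightarrow> 'a measure"
    and \<X> :: "(real \<Rightarrow> 'a \<Rightarrow> real) set"
  assumes time: "time_set I T"
    and filtration_subalgebra: "t \<in> I \<Longrightarrow> subalgebra M (F t)"
    and filtration_mono: "s \<in> I \<Longrightarrow> t \<in> I \<Longrightarrow> s \<le> t \<Longrightarrow> sets (F s) \<subseteq> sets (F t)"
    and filtration_terminal: "sets (F T) = sets M"
    and filtration_initial: "A \<in> sets (F 0) \<Longrightarrow> prob A = 0 \<or> prob A = 1"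
    and processes_adapted: "X \<in> \<X> \<Longrightarrow> adapted I F X"
    and processes_nonneg: "X \<in> \<X> \<Longrightarrow> t \<in> I \<Longrightarrow> \<omega> \<in> space M \<Longrightarrow> 0 \<le> X t \<omega>"
    and one_process: "(\<lambda>t \<omega>. 1) \<in> \<X>"
    and scale_process: "X \<in> \<X> \<Longrightarrow> 0 < c \<Longrightarrow> (\<lambda>t \<omega>. c * X t \<omega>) \<in> \<X>"
    and ex_numeraire: "\<exists>V. numeraire_portfolio M I F \<X> V"

text \<open>A large market is a sequence of markets indexed by \<open>n \<ge> 1\<close>; the entries for \<open>n = 0\<close> are unused.\<close>

definition large_market ::
  "(nat \<Rightarrow> 'a measure) \<Rightarrow> (nat \<Rightarrow> real set) \<Rightarrow> (nat \<Rightarrow> real) \<Rightarrow> (nat \<Rightarrow> real \<Rightarrow> 'a measure)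
     \<Rightarrow> (nat \<Rightarrow> (real \<Rightarrow> 'a \<Rightarrow> real) set) \<Rightarrow> bool" where
  "large_market M I T F \<X> \<longleftrightarrow> (\<forall>n\<ge>1. market (M n) (I n) (T n) (F n) (\<X> n))"

definition strong_asymptotic_arbitrage ::
  "(nat \<Rightarrow> 'a measure) \<Rightarrow> (nat \<Rightarrow> real) \<Rightarrow> (nat \<Rightarrow> (real \<Rightarrow> 'a \<Rightarrow> real) set) \<Rightarrow> bool" where
  "strong_asymptotic_arbitrage M T \<X> \<longleftrightarrow>
     (\<exists>X x. (\<forall>n\<ge>1. X n \<in> \<X> n \<and> starts_at (M n) (X n) (x n)) \<and>
            x \<longlonglongrightarrow> 0 \<and>
            limsup (\<lambda>n. ereal \<P>(\<omega> in M n. X n (T n) \<omega> \<ge> 1)) = 1)"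

text \<open>For \<open>y \<ge> 0\<close> this is \<open>y\<close> to the power \<open>- \<alpha>\<close>, whereas \<open>0 powr (- \<alpha>) = 0\<close>.\<close>

definition neg_power :: "real \<Rightarrow> real \<Rightarrow> ennreal" where
  "neg_power \<alpha> y = (if y = 0 then \<infinity> else ennreal (y powr (- \<alpha>)))"

end

theory Submission
  imports Defs
begin

text \<open>
  The numeraire portfolio turns a wealth process \<open>X\<close> with initial capital \<open>x\<close> into a non-negative
  supermartingale \<open>X / V\<close>, so \<open>E (X\<^sub>T / V\<^sub>T) \<le> x\<close>; the process \<open>1\<close> gives \<open>E (1 / V\<^sub>T) \<le> 1\<close> (\<open>budget\<close>).

  If \<open>X\<close> is nearly an arbitrage, that is, \<open>x\<close> and \<open>P (X\<^sub>T < 1)\<close> are both small, then \<open>1 / V\<^sub>T\<close> is small in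
  mean on \<open>{X\<^sub>T \<ge> 1}\<close>, where it is below \<open>X\<^sub>T / V\<^sub>T\<close>, while the complement has small probability and
  \<open>1 / V\<^sub>T\<close> has mean at most \<open>1\<close> there. A power of \<open>1 / V\<^sub>T\<close> with exponent below one cannot keep its mass on
  a set of small probability, so the mean of this power is small. The exponent \<open>1/2\<close> suffices and reduces the
  Hoelder inequality to the arithmetic-geometric mean inequality
  (\<open>expectation_sqrt_numeraire_le\<close>).

  Condition (c) follows from (b) with \<open>Y = V\<close>. Conversely, if \<open>E (Y\<^sub>T)\<^sup>-\<^sup>\<alpha>\<close> is small then, by Markov's
  inequality, \<open>Y\<^sub>T\<close> is large with probability close to one, so a small multiple \<open>d Y\<close> still ends
  above \<open>1\<close> (\<open>prob_scaled_ge_one\<close>). Since the means are small only along a subsequence whereas the initial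
  capitals \<open>d\<close> must converge to zero along the whole sequence, the factors are chosen to decay
  slowly, at a rate dictated by the subsequence (\<open>slow_null_sequence\<close>).
\<close>

section \<open>Lower and upper limits in terms of frequent events\<close>

lemma frequently_less_if_Liminf_less:
  fixes f :: "_ \<Rightarrow> _ :: complete_linorder"
  shows "Liminf G f < c \<Longrightarrow> \<exists>\<^sub>F n in G. f n < c"
  using Liminf_bounded[of c f G] by (auto simp: frequently_def not_less dest: leD)

lemma Liminf_le_if_frequently_le:
  fixes f :: "_ \<Rightarrow> _ :: complete_linorder"
  shows "\<exists>\<^sub>F n in G. f n \<le> c \<Longrightarrow> Liminf G f \<le> c"
  using less_LiminfD[of c G f] by (auto simp: frequently_def not_le intro: leI)

lemma frequently_less_if_less_Limsup:
  fixes f :: "_ \<Rightarrow> _ :: complete_linorder"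
  shows "c < Limsup G f \<Longrightarrow> \<exists>\<^sub>F n in G. c < f n"
  using Limsup_bounded[of f c G] by (auto simp: frequently_def not_less dest: leD)

lemma le_Limsup_if_frequently_le:
  fixes f :: "_ \<Rightarrow> _ :: complete_linorder"
  shows "\<exists>\<^sub>F n in G. c \<le> f n \<Longrightarrow> c \<le> Limsup G f"
  using Limsup_lessD[of G f c] by (auto simp: frequently_def not_le intro: leI)

section \<open>Null sequences that dominate along a subsequence\<close>

text \<open>
  Along a subsequence \<open>r\<close> with \<open>e (r k) < (1 / (k + 1)) powr p\<close> the value \<open>1 / (k + 1)\<close> would do. It is
  extended to all indices by keeping it constant on the blocks between consecutive \<open>r k\<close>, so that
  it converges to zero along the whole sequence.
\<close>

lemma slow_null_sequence:
  fixes e :: "nat \<Rightarrow> ennreal" and p :: real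
  assumes "liminf e = 0"
  obtains d :: "nat \<Rightarrow> real"
    where "\<And>n. 0 < d n" "d \<longlonglongrightarrow> 0" "\<exists>\<^sub>F n in sequentially. e n < ennreal (d n powr p)"
proof -
  have "\<exists>n>N. e n < ennreal ((1 / real (Suc k)) powr p)" for N k
  proof -
    have "liminf e < ennreal ((1 / real (Suc k)) powr p)"
      using assms by simp
    then have "\<exists>\<^sub>F n in sequentially. e n < ennreal ((1 / real (Suc k)) powr p)"
      by (rule frequently_less_if_Liminf_less)
    then show ?thesis
      unfolding frequently_sequentially by (meson Suc_le_eq)
  qed
  then obtain g where g: "\<And>N k. g N k > N"
    and eg: "\<And>N k. e (g N k) < ennreal ((1 / real (Suc k)) powr p)"
    by metis
  define r where "r = rec_nat (g 0 0) (\<lambda>k N. g N (Suc k))"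
  have r_Suc: "r (Suc k) = g (r k) (Suc k)" for k
    by (simp add: r_def)
  have r: "strict_mono r"
    by (simp add: strict_mono_Suc_iff r_Suc g)
  have er: "e (r k) < ennreal ((1 / real (Suc k)) powr p)" for k
    by (cases k) (simp_all only: r_Suc eg, simp only: r_def nat.rec eg)
  define block where "block n = (LEAST k. n \<le> r k)" for n
  define d where "d n = 1 / real (Suc (block n))" for n
  have block_r: "block (r k) = k" for k
    unfolding block_def using r by (intro Least_equality) (auto simp: strict_mono_less_eq)
  have "block n \<ge> K" if "n \<ge> Suc (r K)" for n K
  proof (rule ccontr)
    assume "\<not> K \<le> block n"
    then have "r (block n) \<le> r K"
      using r by (simp add: strict_mono_less_eq)
    moreover have "n \<le> r (block n)"
      unfolding block_def by (rule LeastI[of _ n]) (use r strict_mono_imp_increasing in blast)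
    ultimately show False
      using that by simp
  qed
  then have "filterlim block at_top sequentially"
    unfolding filterlim_at_top eventually_sequentially by blast
  then have "d \<longlonglongrightarrow> 0"
    unfolding d_def
    using filterlim_compose[OF LIMSEQ_inverse_real_of_nat] by (simp add: inverse_eq_divide)
  moreover have "\<exists>\<^sub>F n in sequentially. e n < ennreal (d n powr p)"
    unfolding frequently_sequentially
    using er block_r r by (metis d_def strict_mono_imp_increasing)
  moreover have "\<And>n. 0 < d n"
    by (simp add: d_def)
  ultimately show thesis
    using that by blast
qed

section \<open>Budget and tail estimates in a single market\<close>

context market
begin

lemma zero_in_time: "0 \<in> I" and terminal_in_time: "T \<in> I"
  using time unfolding time_set_def by force+

lemma process_measurable:
  assumes "X \<in> \<X>"
  shows "X T \<in> borel_measurable M"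
  using assms processes_adapted terminal_in_time filtration_subalgebra measurable_from_subalg
  unfolding adapted_def by blast

text \<open>
  The supermartingale inequality between the times \<open>0\<close> and \<open>T\<close>, integrated; as \<open>V\<close> starts at \<open>1\<close>,
  the initial value of \<open>X / V\<close> is almost surely the number \<open>x\<close>.
\<close>

lemma budget:
  assumes V: "numeraire_portfolio M I F \<X> V" and X: "X \<in> \<X>" "starts_at M X x"
  shows "integrable M (\<lambda>\<omega>. X T \<omega> / V T \<omega>)" and "expectation (\<lambda>\<omega>. X T \<omega> / V T \<omega>) \<le> x"
proof -
  let ?Z = "\<lambda>t \<omega>. X t \<omega> / V t \<omega>"
  have Z: "supermartingale M I F ?Z" and V0: "AE \<omega> in M. V 0 \<omega> = 1"
    using V X unfolding numeraire_portfolio_def unit_processes_def starts_at_def by auto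
  show int: "integrable M (?Z T)"
    using Z terminal_in_time unfolding supermartingale_def by blast
  interpret F0: finite_measure_subalgebra M "F 0"
    by unfold_locales (rule filtration_subalgebra[OF zero_in_time])
  have "0 \<le> T"
    using time unfolding time_set_def by simp
  then have "AE \<omega> in M. real_cond_exp M (F 0) (?Z T) \<omega> \<le> ?Z 0 \<omega>"
    using Z zero_in_time terminal_in_time unfolding supermartingale_def by blast
  moreover have "AE \<omega> in M. X 0 \<omega> = x"
    using X(2) unfolding starts_at_def .
  ultimately have "AE \<omega> in M. real_cond_exp M (F 0) (?Z T) \<omega> \<le> x"
    using V0 by eventually_elim simp
  then have "expectation (real_cond_exp M (F 0) (?Z T)) \<le> expectation (\<lambda>_. x)"
    by (intro integral_mono_AE) (auto intro: F0.real_cond_exp_int(1)[OF int])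
  then show "expectation (?Z T) \<le> x"
    using F0.real_cond_exp_int(2)[OF int] by (simp add: prob_space)
qed

text \<open>
  With \<open>u = (V\<^sub>T)\<^sup>-\<^sup>1\<^sup>/\<^sup>2\<close>, the arithmetic-geometric mean inequality is applied as \<open>2 u \<le> s + u\<^sup>2 / s\<close>
  where \<open>X\<^sub>T \<ge> 1\<close> and as \<open>2 u \<le> s u\<^sup>2 + 1 / s\<close> elsewhere. The first puts the large weight \<open>1 / s\<close> on
  \<open>u\<^sup>2 \<le> X\<^sub>T / V\<^sub>T\<close>, which has mean at most \<open>x\<close>, the second on the indicator of a set that is small in the
  application. The parameter \<open>s\<close> remains free, to be taken small but fixed while \<open>x\<close> and
  \<open>P (X\<^sub>T < 1)\<close> tend to zero.
\<close>

lemma expectation_sqrt_numeraire_le: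
  assumes V: "numeraire_portfolio M I F \<X> V" and X: "X \<in> \<X>" "starts_at M X x" and s: "0 < s"
  shows "(\<integral>\<^sup>+ \<omega>. neg_power (1/2) (V T \<omega>) \<partial>M)
    \<le> ennreal (s + (x + (1 - \<P>(\<omega> in M. X T \<omega> \<ge> 1))) / (2 * s))"
proof -
  define A where "A = {\<omega> \<in> space M. X T \<omega> \<ge> 1}"
  have XM [measurable]: "X T \<in> borel_measurable M"
    by (rule process_measurable[OF X(1)])
  have A [measurable]: "A \<in> sets M"
    unfolding A_def by measurable
  have one_at_one: "starts_at M (\<lambda>t \<omega>. 1) 1"
    by (simp add: starts_at_def)
  define w where "w \<omega> = 1 / V T \<omega>" for \<omega>
  define z where "z \<omega> = X T \<omega> / V T \<omega>" for \<omega>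
  have w: "integrable M w" "expectation w \<le> 1" and z: "integrable M z" "expectation z \<le> x"
    using budget[OF V one_process one_at_one] budget[OF V X] unfolding w_def z_def by blast+
  have ind: "integrable M (indicator (space M - A) :: _ \<Rightarrow> real)"
    by (simp add: less_top[symmetric])
  let ?g = "\<lambda>\<omega>. s / 2 + s / 2 * w \<omega> + (z \<omega> + indicator (space M - A) \<omega>) / (2 * s)"
  have pointwise: "V T \<omega> powr (- (1/2)) \<le> ?g \<omega>" and V_pos: "0 < V T \<omega>"
    if \<omega>: "\<omega> \<in> space M" for \<omega>
  proof -
    show pos: "0 < V T \<omega>"
      using V \<omega> terminal_in_time unfolding numeraire_portfolio_def by blast
    define u where "u = V T \<omega> powr (- (1/2))"
    have u: "0 < u" "u\<^sup>2 = 1 / V T \<omega>"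
      using pos by (auto simp: u_def power2_eq_square powr_minus_divide simp flip: powr_add)
    have "u \<le> s / 2 + s / 2 * u\<^sup>2 + (X T \<omega> * u\<^sup>2 + indicator (space M - A) \<omega>) / (2 * s)"
    proof (cases "\<omega> \<in> A")
      case True
      have "0 \<le> (u - s)\<^sup>2"
        by simp
      then have "2 * s * u \<le> s\<^sup>2 + u\<^sup>2"
        by (simp add: power2_diff algebra_simps)
      also have "u\<^sup>2 \<le> X T \<omega> * u\<^sup>2"
        using True by (intro mult_le_cancel_right1[THEN iffD2]) (auto simp: A_def)
      finally have "u \<le> (s\<^sup>2 + X T \<omega> * u\<^sup>2) / (2 * s)"
        using s by (simp add: field_simps)
      also have "\<dots> = s / 2 + X T \<omega> * u\<^sup>2 / (2 * s)"
        using s by (simp add: field_simps power2_eq_square)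
      also have "\<dots> \<le> s / 2 + s / 2 * u\<^sup>2 + X T \<omega> * u\<^sup>2 / (2 * s)"
        using s by simp
      finally show ?thesis
        using True by simp
    next
      case False
      have "0 \<le> (s * u - 1)\<^sup>2"
        by simp
      then have "2 * s * u \<le> s\<^sup>2 * u\<^sup>2 + 1"
        by (simp add: power2_diff power_mult_distrib algebra_simps)
      then have "u \<le> (s\<^sup>2 * u\<^sup>2 + 1) / (2 * s)"
        using s by (simp add: field_simps)
      also have "\<dots> = s / 2 * u\<^sup>2 + 1 / (2 * s)"
        using s by (simp add: field_simps power2_eq_square)
      also have "\<dots> \<le> s / 2 + s / 2 * u\<^sup>2 + (X T \<omega> * u\<^sup>2 + 1) / (2 * s)"
        using s processes_nonneg[OF X(1) terminal_in_time \<omega>]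
        by (intro add_mono divide_right_mono) auto
      finally show ?thesis
        using False \<omega> by simp
    qed
    then show "V T \<omega> powr (- (1/2)) \<le> ?g \<omega>"
      unfolding u(2) by (simp add: u_def w_def z_def)
  qed
  have int: "integrable M ?g"
    using w(1) z(1) ind by simp
  have "(\<integral>\<^sup>+ \<omega>. neg_power (1/2) (V T \<omega>) \<partial>M) \<le> (\<integral>\<^sup>+ \<omega>. ennreal (?g \<omega>) \<partial>M)"
    using pointwise V_pos
    by (intro nn_integral_mono) (auto simp: neg_power_def less_imp_neq[symmetric] intro!: ennreal_leI)
  also have "\<dots> = ennreal (expectation ?g)"
    using int by (rule nn_integral_eq_integral)
      (use pointwise in \<open>auto intro!: AE_I2 order_trans[OF powr_ge_zero]\<close>)
  also have "expectation ?g = s / 2 + s / 2 * expectation w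
      + (expectation z + prob (space M - A)) / (2 * s)"
    using w(1) z(1) ind by (simp add: prob_space)
  also have "\<dots> \<le> s / 2 + s / 2 * 1 + (x + prob (space M - A)) / (2 * s)"
    using s w(2) z(2) by (intro add_mono mult_left_mono divide_right_mono) auto
  also have "\<dots> = s + (x + (1 - \<P>(\<omega> in M. X T \<omega> \<ge> 1))) / (2 * s)"
    using prob_compl[OF A] by (simp add: A_def)
  finally show ?thesis
    by (simp add: ennreal_leI)
qed

text \<open>
  Markov's inequality at the level \<open>d\<^sup>\<alpha>\<close>: where \<open>d Y\<^sub>T < 1\<close>, the negative power of \<open>Y\<^sub>T\<close> is at least
  that large, and this includes bankruptcy, \<open>Y\<^sub>T = 0\<close>, because the negative power is infinite there.
\<close>

lemma prob_scaled_ge_one: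
  assumes Y: "Y \<in> \<X>" and d: "0 < d" and \<alpha>: "0 < \<alpha>"
    and small: "(\<integral>\<^sup>+ \<omega>. neg_power \<alpha> (Y T \<omega>) \<partial>M) \<le> ennreal (d powr (1 + \<alpha>))"
  shows "1 - d \<le> \<P>(\<omega> in M. d * Y T \<omega> \<ge> 1)"
proof -
  have YM [measurable]: "Y T \<in> borel_measurable M"
    by (rule process_measurable[OF Y])
  have [measurable]: "(\<lambda>\<omega>. neg_power \<alpha> (Y T \<omega>)) \<in> borel_measurable M"
    unfolding neg_power_def by measurable
  define A where "A = {\<omega> \<in> space M. d * Y T \<omega> \<ge> 1}"
  have A [measurable]: "A \<in> sets M"
    unfolding A_def by measurable
  have "1 \<le> ennreal (d powr (- \<alpha>)) * neg_power \<alpha> (Y T \<omega>)" if \<omega>: "\<omega> \<in> space M - A" for \<omega>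
  proof (cases "Y T \<omega> = 0")
    case True
    then show ?thesis
      using d by (simp add: neg_power_def ennreal_mult_top)
  next
    case False
    then have pos: "0 < Y T \<omega>" "d * Y T \<omega> < 1"
      using \<omega> processes_nonneg[OF Y terminal_in_time, of \<omega>] by (auto simp: A_def)
    have "1 \<le> (d * Y T \<omega>) powr (- \<alpha>)"
      using powr_mono2'[of "- \<alpha>" "d * Y T \<omega>" 1] d \<alpha> pos by simp
    also have "\<dots> = d powr (- \<alpha>) * Y T \<omega> powr (- \<alpha>)"
      using d pos by (simp add: powr_mult)
    finally show ?thesis
      using False by (simp add: neg_power_def ennreal_leI flip: ennreal_mult ennreal_1)
  qed
  then have "emeasure M (space M - A)
      \<le> emeasure M ({\<omega> \<in> space M. 1 \<le> ennreal (d powr (- \<alpha>)) * neg_power \<alpha> (Y T \<omega>)})"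
    by (intro emeasure_mono) auto
  also have "\<dots> \<le> ennreal (d powr (- \<alpha>)) * (\<integral>\<^sup>+ \<omega>. neg_power \<alpha> (Y T \<omega>) \<partial>M)"
    using nn_integral_Markov_inequality[of "\<lambda>\<omega>. neg_power \<alpha> (Y T \<omega>)" "space M" M]
    by (simp cong: nn_integral_cong)
  also have "\<dots> \<le> ennreal (d powr (- \<alpha>)) * ennreal (d powr (1 + \<alpha>))"
    by (intro mult_left_mono small) simp
  also have "\<dots> = ennreal d"
    using d by (simp add: flip: ennreal_mult powr_add)
  finally have "prob (space M - A) \<le> d"
    using d by (simp add: emeasure_eq_measure)
  then show ?thesis
    using prob_compl[OF A] by (simp add: A_def)
qed

end

section \<open>Strong asymptotic arbitrage in a large market\<close>

lemma liminf_numeraire_if_arbitrage: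
  assumes market: "\<And>n. n \<ge> 1 \<Longrightarrow> market (M n) (I n) (T n) (F n) (\<X> n)"
    and V: "\<And>n. n \<ge> 1 \<Longrightarrow> numeraire_portfolio (M n) (I n) (F n) (\<X> n) (V n)"
    and arb: "strong_asymptotic_arbitrage M T \<X>"
  shows "liminf (\<lambda>n. \<integral>\<^sup>+ \<omega>. neg_power (1/2) (V n (T n) \<omega>) \<partial>M n) = 0"
proof -
  from arb obtain X x
    where X: "\<And>n. n \<ge> 1 \<Longrightarrow> X n \<in> \<X> n" "\<And>n. n \<ge> 1 \<Longrightarrow> starts_at (M n) (X n) (x n)"
      and x: "x \<longlonglongrightarrow> 0"
      and p: "limsup (\<lambda>n. ereal \<P>(\<omega> in M n. X n (T n) \<omega> \<ge> 1)) = 1"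
    unfolding strong_asymptotic_arbitrage_def by blast
  define e where "e n = (\<integral>\<^sup>+ \<omega>. neg_power (1/2) (V n (T n) \<omega>) \<partial>M n)" for n
  have "liminf e \<le> ennreal \<epsilon>" if \<epsilon>: "0 < \<epsilon>" for \<epsilon> :: real
  proof -
    \<comment> \<open>With \<open>s = \<epsilon> / 2\<close> the bound \<open>s + (x + (1 - p)) / (2 * s)\<close> is at most \<open>\<epsilon>\<close> once \<open>x\<close> and \<open>1 - p\<close>
      are both at most \<open>\<epsilon>\<^sup>2 / 4\<close>.\<close>
    have "ereal (1 - \<epsilon>\<^sup>2 / 4) < limsup (\<lambda>n. ereal \<P>(\<omega> in M n. X n (T n) \<omega> \<ge> 1))"
      using \<epsilon> unfolding p by (simp add: one_ereal_def)
    then have "\<exists>\<^sub>F n in sequentially. ereal (1 - \<epsilon>\<^sup>2 / 4) < ereal \<P>(\<omega> in M n. X n (T n) \<omega> \<ge> 1)"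
      by (rule frequently_less_if_less_Limsup)
    moreover have "\<forall>\<^sub>F n in sequentially. x n < \<epsilon>\<^sup>2 / 4 \<and> n \<ge> 1"
      using order_tendstoD(2)[OF x, of "\<epsilon>\<^sup>2 / 4"] \<epsilon> eventually_ge_at_top[of 1]
      by (auto intro: eventually_conj)
    ultimately have "\<exists>\<^sub>F n in sequentially. (x n < \<epsilon>\<^sup>2 / 4 \<and> n \<ge> 1)
        \<and> ereal (1 - \<epsilon>\<^sup>2 / 4) < ereal \<P>(\<omega> in M n. X n (T n) \<omega> \<ge> 1)"
      by (rule frequently_eventually_conj)
    then have "\<exists>\<^sub>F n in sequentially. e n \<le> ennreal \<epsilon>"
    proof (rule frequently_elim1, elim conjE)
      fix n
      assume n: "n \<ge> 1" "x n < \<epsilon>\<^sup>2 / 4"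
        and pn: "ereal (1 - \<epsilon>\<^sup>2 / 4) < ereal \<P>(\<omega> in M n. X n (T n) \<omega> \<ge> 1)"
      let ?p = "\<P>(\<omega> in M n. X n (T n) \<omega> \<ge> 1)"
      interpret market "M n" "I n" "T n" "F n" "\<X> n"
        by (rule market[OF n(1)])
      have "e n \<le> ennreal (\<epsilon> / 2 + (x n + (1 - ?p)) / (2 * (\<epsilon> / 2)))"
        unfolding e_def using n(1) \<epsilon>
        by (intro expectation_sqrt_numeraire_le V X) auto
      also have "\<dots> \<le> ennreal \<epsilon>"
      proof (rule ennreal_leI)
        have "(x n + (1 - ?p)) / \<epsilon> \<le> (\<epsilon>\<^sup>2 / 2) / \<epsilon>"
          using n(2) pn \<epsilon> by (intro divide_right_mono) auto
        also have "\<dots> = \<epsilon> / 2"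
          using \<epsilon> by (simp add: power2_eq_square)
        finally have "\<epsilon> / 2 + (x n + (1 - ?p)) / \<epsilon> \<le> \<epsilon>"
          by linarith
        then show "\<epsilon> / 2 + (x n + (1 - ?p)) / (2 * (\<epsilon> / 2)) \<le> \<epsilon>"
          by simp
      qed
      finally show "e n \<le> ennreal \<epsilon>" .
    qed
    then show ?thesis
      by (rule Liminf_le_if_frequently_le)
  qed
  then have "liminf e \<le> 0"
    using ennreal_le_epsilon[of 0 "liminf e"] by simp
  then show ?thesis
    by (simp add: e_def[abs_def])
qed

lemma arbitrage_if_liminf_unit_processes:
  assumes market: "\<And>n. n \<ge> 1 \<Longrightarrow> market (M n) (I n) (T n) (F n) (\<X> n)"
    and Y: "\<And>n. n \<ge> 1 \<Longrightarrow> Y n \<in> unit_processes (M n) (\<X> n)"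
    and \<alpha>: "0 < \<alpha>" and lim: "liminf (\<lambda>n. \<integral>\<^sup>+ \<omega>. neg_power \<alpha> (Y n (T n) \<omega>) \<partial>M n) = 0"
  shows "strong_asymptotic_arbitrage M T \<X>"
proof -
  \<comment> \<open>The exponent splits as \<open>\<alpha>\<close>, the loss in Markov's inequality, and \<open>1\<close>, which leaves the
    exceptional probability at most \<open>d\<close>.\<close>
  obtain d where d: "\<And>n. 0 < d n" "d \<longlonglongrightarrow> 0"
    and freq: "\<exists>\<^sub>F n in sequentially.
      (\<integral>\<^sup>+ \<omega>. neg_power \<alpha> (Y n (T n) \<omega>) \<partial>M n) < ennreal (d n powr (1 + \<alpha>))"
    using slow_null_sequence[OF lim] by blast
  define X where "X n t \<omega> = d n * Y n t \<omega>" for n t \<omega>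
  define p where "p n = \<P>(\<omega> in M n. X n (T n) \<omega> \<ge> 1)" for n
  have "X n \<in> \<X> n \<and> starts_at (M n) (X n) (d n)" if n: "n \<ge> 1" for n
  proof -
    interpret market "M n" "I n" "T n" "F n" "\<X> n"
      by (rule market[OF n])
    have "Y n \<in> \<X> n" "starts_at (M n) (Y n) 1"
      using Y[OF n] by (auto simp: unit_processes_def)
    then show ?thesis
      using scale_process[OF _ d(1)] by (auto simp: X_def[abs_def] starts_at_def)
  qed
  moreover have "limsup (\<lambda>n. ereal (p n)) = 1"
  proof (rule antisym)
    have "\<forall>\<^sub>F n in sequentially. ereal (p n) \<le> 1"
      using eventually_ge_at_top[of 1]
    proof eventually_elim
      case (elim n)
      interpret market "M n" "I n" "T n" "F n" "\<X> n"
        by (rule market[OF elim])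
      show ?case
        by (simp add: p_def)
    qed
    then show "limsup (\<lambda>n. ereal (p n)) \<le> 1"
      by (rule Limsup_bounded)
  next
    have bound: "1 - d n \<le> p n"
      if n: "n \<ge> 1" "(\<integral>\<^sup>+ \<omega>. neg_power \<alpha> (Y n (T n) \<omega>) \<partial>M n) < ennreal (d n powr (1 + \<alpha>))" for n
    proof -
      interpret market "M n" "I n" "T n" "F n" "\<X> n"
        by (rule market[OF n(1)])
      show ?thesis
        unfolding p_def X_def using Y[OF n(1)] n(2) d(1) \<alpha>
        by (intro prob_scaled_ge_one) (auto simp: unit_processes_def)
    qed
    show "1 \<le> limsup (\<lambda>n. ereal (p n))"
    proof (rule dense_le)
      fix y :: ereal
      assume "y < 1"
      moreover have "(\<lambda>n. ereal (1 - d n)) \<longlonglongrightarrow> 1"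
        using tendsto_diff[OF tendsto_const d(2), of 1] by (simp add: one_ereal_def)
      ultimately have "\<forall>\<^sub>F n in sequentially. y < ereal (1 - d n) \<and> n \<ge> 1"
        by (intro eventually_conj order_tendstoD(1) eventually_ge_at_top)
      with freq have "\<exists>\<^sub>F n in sequentially. y \<le> ereal (p n)"
        by (rule frequently_elim1[OF frequently_eventually_conj])
          (use bound in \<open>force intro: less_imp_le less_le_trans\<close>)
      then show "y \<le> limsup (\<lambda>n. ereal (p n))"
        by (rule le_Limsup_if_frequently_le)
    qed
  qed
  ultimately show ?thesis
    unfolding strong_asymptotic_arbitrage_def p_def using d(2) by blast
qed

theorem theorem2p8:
  fixes M :: "nat \<Rightarrow> 'a measure"
    and I :: "nat \<Rightarrow> real set"
    and T :: "nat \<Rightarrow> real"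
    and F :: "nat \<Rightarrow> real \<Rightarrow> 'a measure"
    and \<X> :: "nat \<Rightarrow> (real \<Rightarrow> 'a \<Rightarrow> real) set"
    and V :: "nat \<Rightarrow> real \<Rightarrow> 'a \<Rightarrow> real"
  assumes "large_market M I T F \<X>"
    and "\<And>n. n \<ge> 1 \<Longrightarrow> numeraire_portfolio (M n) (I n) (F n) (\<X> n) (V n)"
  defines "SAA \<equiv> strong_asymptotic_arbitrage M T \<X>"
    and "cond_b \<equiv> (\<exists>\<alpha>::real. 0 < \<alpha> \<and> \<alpha> < 1 \<and>
           liminf (\<lambda>n. \<integral>\<^sup>+ \<omega>. neg_power \<alpha> (V n (T n) \<omega>) \<partial>M n) = 0)"
    and "cond_c \<equiv> (\<exists>Y. (\<forall>n\<ge>1. Y n \<in> unit_processes (M n) (\<X> n)) \<and>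
           (\<exists>\<alpha>::real. 0 < \<alpha> \<and> \<alpha> < 1 \<and>
             liminf (\<lambda>n. \<integral>\<^sup>+ \<omega>. neg_power \<alpha> (Y n (T n) \<omega>) \<partial>M n) = 0))"
  shows "(SAA \<longleftrightarrow> cond_b) \<and> (cond_b \<longleftrightarrow> cond_c)"
proof -
  have market: "\<And>n. n \<ge> 1 \<Longrightarrow> market (M n) (I n) (T n) (F n) (\<X> n)"
    using assms(1) unfolding large_market_def by blast
  have "cond_b" if "SAA"
  proof -
    have "liminf (\<lambda>n. \<integral>\<^sup>+ \<omega>. neg_power (1/2) (V n (T n) \<omega>) \<partial>M n) = 0"
      using market assms(2) that unfolding SAA_def by (rule liminf_numeraire_if_arbitrage)
    then show ?thesis
      unfolding cond_b_def by (intro exI[of _ "1/2"]) simp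
  qed
  moreover have "cond_c" if "cond_b"
    unfolding cond_c_def
  proof (intro exI[of _ V] conjI allI impI)
    show "V n \<in> unit_processes (M n) (\<X> n)" if "n \<ge> 1" for n
      using assms(2)[OF that] unfolding numeraire_portfolio_def by blast
    show "\<exists>\<alpha>::real. 0 < \<alpha> \<and> \<alpha> < 1 \<and>
             liminf (\<lambda>n. \<integral>\<^sup>+ \<omega>. neg_power \<alpha> (V n (T n) \<omega>) \<partial>M n) = 0"
      using that unfolding cond_b_def .
  qed
  moreover have "SAA" if "cond_c"
    using that market unfolding cond_c_def SAA_def
    by (blast intro: arbitrage_if_liminf_unit_processes)
  ultimately show ?thesis
    by blast
qed

end
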